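(* Let $\mathcal P_o=(P,R,g)$ be a normalised OPS instance. For all $x\ge 4$, the maximum heat achieved by any edge in the schedule produced by Reduce-Fastest$(x)$ is strictly less than $x+2$.
   Context: An OPS instance $(P,R,g)$ consists of a finite simple undirected graph $(P,R)$ with growth rates $g:R\to\mathbb R_{>0}$. For $v\in P$ let $G_v=\sum_{e\in R:\,v\in e} g(e)$ and $G^*=\max_v G_v$; the instance is normalised if $G^*=1$. Reduce-Fastest$(x)$: sort edges by non-increasing growth rate (ties broken by an arbitrary fixed ordering). Each edge has a current heat, initially $0$, which increases by $g(e)$ at the beginning of each day. Each day a matching $M$ is built greedily: in the sorted order, an edge $e=\{u,v\}$ is added to $M$ iff its current heat is at least $x G^*$ and no edge incident to $u$ or $v$ is already in $M$; the edges of $M$ are scheduled that day and their current heat reset to $0$. *)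

theory Defs
  imports Complex_Main "HOL-Library.Extended_Real"
begin

text \<open>Edges are two-element sets of vertices; values of \<open>g\<close> outside \<open>R\<close> are irrelevant.\<close>

locale ops_instance =
  fixes P :: "'v set" and R :: "'v set set" and g :: "'v set \<Rightarrow> real"
  assumes finite_P: "finite P"
    and edges: "R \<subseteq> {{u, v} | u v. u \<in> P \<and> v \<in> P \<and> u \<noteq> v}"
    and growth_pos: "\<And>e. e \<in> R \<Longrightarrow> g e > 0"

definition vertex_growth :: "'v set set \<Rightarrow> ('v set \<Rightarrow> real) \<Rightarrow> 'v \<Rightarrow> real" where
  "vertex_growth R g v = (\<Sum>e\<in>{e \<in> R. v \<in> e}. g e)"

definition max_growth :: "'v set \<Rightarrow> 'v set set \<Rightarrow> ('v set \<Rightarrow> real) \<Rightarrow> real" where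
  "max_growth P R g = Max (vertex_growth R g ` P)"

definition normalised :: "'v set \<Rightarrow> 'v set set \<Rightarrow> ('v set \<Rightarrow> real) \<Rightarrow> bool" where
  "normalised P R g \<longleftrightarrow> max_growth P R g = 1"

text \<open>\<open>heat g S t e\<close> is the heat of \<open>e\<close> on day \<open>t\<close> (days are numbered from 0) under the
  schedule \<open>S\<close>, after that day's growth and before the edges in \<open>S t\<close> are reset;
  this is where the heat of an edge peaks.\<close>

primrec heat :: "('v set \<Rightarrow> real) \<Rightarrow> (nat \<Rightarrow> 'v set set) \<Rightarrow> nat \<Rightarrow> 'v set \<Rightarrow> real" where
  "heat g S 0 e = 0 + g e"
| "heat g S (Suc t) e = (if e \<in> S t then 0 else heat g S t e) + g e"

text \<open>The supremum is taken in the extended reals so that it is meaningful without a priori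
  boundedness. When it is finite it is attained, the heats of \<open>e\<close> being multiples of \<open>g e\<close>
  and \<open>R\<close> being finite.\<close>

definition max_heat :: "'v set set \<Rightarrow> ('v set \<Rightarrow> real) \<Rightarrow> (nat \<Rightarrow> 'v set set) \<Rightarrow> ereal" where
  "max_heat R g S = (SUP e\<in>R. SUP t. ereal (heat g S t e))"

text \<open>A list of all edges by non-increasing growth rate. Any list of this kind
  corresponds to one way of breaking ties.\<close>

definition growth_order :: "'v set set \<Rightarrow> ('v set \<Rightarrow> real) \<Rightarrow> 'v set list \<Rightarrow> bool" where
  "growth_order R g es \<longleftrightarrow>
     distinct es \<and> set es = R \<and> sorted_wrt (\<lambda>e f. g e \<ge> g f) es"

definition greedy_matching :: "real \<Rightarrow> 'v set list \<Rightarrow> ('v set \<Rightarrow> real) \<Rightarrow> 'v set set" where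
  "greedy_matching \<theta> es h =
     fold (\<lambda>e M. if h e \<ge> \<theta> \<and> (\<forall>f\<in>M. f \<inter> e = {}) then insert e M else M) es {}"

text \<open>The current heats maintained by the algorithm, at the same moment of the day as in \<open>heat\<close>.\<close>

primrec rf_heat :: "real \<Rightarrow> 'v set list \<Rightarrow> ('v set \<Rightarrow> real) \<Rightarrow> nat \<Rightarrow> 'v set \<Rightarrow> real" where
  "rf_heat \<theta> es g 0 = (\<lambda>e. 0 + g e)"
| "rf_heat \<theta> es g (Suc t) =
     (\<lambda>e. (if e \<in> greedy_matching \<theta> es (rf_heat \<theta> es g t) then 0 else rf_heat \<theta> es g t e) + g e)"

definition reduce_fastest ::
    "'v set \<Rightarrow> 'v set set \<Rightarrow> ('v set \<Rightarrow> real) \<Rightarrow> 'v set list \<Rightarrow> real \<Rightarrow> nat \<Rightarrow> 'v set set" where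
  "reduce_fastest P R g es x t =
     (let \<theta> = x * max_growth P R g in greedy_matching \<theta> es (rf_heat \<theta> es g t))"

end

theory Submission
  imports Defs
begin

text \<open>Once an edge \<open>e\<close> is hot enough to be scheduled, every day it waits is a day on which an
  adjacent edge \<open>f\<close> with \<open>g f \<ge> g e\<close> is scheduled. Two schedulings of \<open>f\<close> are at least
  \<open>x / g f\<close> days apart, so \<open>f\<close> occurs \<open>n\<close> times in \<open>K\<close> days with \<open>n - 1 \<le> (K - 1) * g f / x\<close>.
  While \<open>(K - 1) * g e \<le> 2 \<le> x / 2\<close> this forces \<open>n \<le> g f / g e\<close>, by integrality if
  \<open>g f < 2 * g e\<close>. As the adjacent edges have total growth at most \<open>2 - 2 * g e\<close>, summing
  over \<open>f\<close> gives \<open>K * g e \<le> 2 - 2 * g e\<close>.\<close>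

lemma greedy_fold_mono:
  "M \<subseteq> fold (\<lambda>e M. if h e \<ge> \<theta> \<and> (\<forall>f\<in>M. f \<inter> e = {}) then insert e M else M) es M"
proof (induction es arbitrary: M)
  case (Cons e es)
  show ?case
    using Cons.IH[of M] Cons.IH[of "insert e M"] by auto
qed simp

lemma greedy_fold_elem:
  assumes "f \<in> fold (\<lambda>e M. if h e \<ge> \<theta> \<and> (\<forall>f\<in>M. f \<inter> e = {}) then insert e M else M) es M"
  shows "f \<in> M \<or> (f \<in> set es \<and> h f \<ge> \<theta>)"
  using assms by (induction es arbitrary: M) (auto split: if_splits)

lemma greedy_matching_hot: "f \<in> greedy_matching \<theta> es h \<Longrightarrow> h f \<ge> \<theta>"
  unfolding greedy_matching_def using greedy_fold_elem[where M = "{}"] by fastforce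

text \<open>When the scan reaches \<open>e\<close>, the partial matching consists of earlier edges,
  whose growth rates are at least \<open>g e\<close>. A hot \<open>e\<close> is rejected only if one
  of them meets it, and a chosen edge is never removed.\<close>

lemma greedy_matching_blocked:
  assumes "sorted_wrt (\<lambda>e f. g e \<ge> (g f :: real)) es" "e \<in> set es" "h e \<ge> \<theta>"
    and "e \<notin> greedy_matching \<theta> es h"
  obtains f where "f \<in> greedy_matching \<theta> es h" "f \<in> set es" "f \<inter> e \<noteq> {}" "g f \<ge> g e"
proof -
  let ?step = "\<lambda>e M. if h e \<ge> \<theta> \<and> (\<forall>f\<in>M. f \<inter> e = {}) then insert e M else M"
  obtain ys zs where es: "es = ys @ e # zs"
    using assms(2) by (meson split_list)
  let ?M = "fold ?step ys {}"
  have eq: "greedy_matching \<theta> es h = fold ?step zs (?step e ?M)"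
    by (simp add: greedy_matching_def es)
  have sub: "?step e ?M \<subseteq> greedy_matching \<theta> es h"
    unfolding eq by (rule greedy_fold_mono)
  have "\<exists>f\<in>?M. f \<inter> e \<noteq> {}"
  proof (rule ccontr)
    assume "\<not> (\<exists>f\<in>?M. f \<inter> e \<noteq> {})"
    then have "e \<in> ?step e ?M" using assms(3) by auto
    with sub assms(4) show False by blast
  qed
  then obtain f where f: "f \<in> ?M" "f \<inter> e \<noteq> {}" by blast
  have "f \<in> ?step e ?M" using f(1) by auto
  with sub have "f \<in> greedy_matching \<theta> es h" by blast
  moreover have "f \<in> set ys" using greedy_fold_elem[OF f(1)] by simp
  ultimately show thesis
    using that f(2) assms(1) by (auto simp: es sorted_wrt_append)
qed

lemma rf_heat_eq_heat:
  "rf_heat (x * max_growth P R g) es g t = heat g (reduce_fastest P R g es x) t"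
  by (induction t) (auto simp: reduce_fastest_def Let_def)

lemma heat_after_scheduling:
  assumes "g f \<ge> 0" "f \<in> S s" "s < t"
  shows "heat g S t f \<le> real (t - s) * g f"
proof -
  \<comment> \<open>Further resets of \<open>f\<close> after day \<open>s\<close> only lower its
    heat, as \<open>g f\<close> is nonnegative.\<close>
  have "heat g S (s + Suc d) f \<le> real (Suc d) * g f" for d
    using assms(1,2) by (induction d) (auto simp: algebra_simps)
  from this[of "t - Suc s"] show ?thesis using assms(3) by (simp add: Suc_diff_Suc)
qed

text \<open>Between \<open>card A\<close> points there are \<open>card A - 1\<close> gaps of size at
  least \<open>d\<close>, while \<open>K\<close> consecutive days span only \<open>K - 1\<close>.
  The induction removes the largest point.\<close>

lemma card_separated_le:
  fixes d :: real
  assumes sep: "\<And>s t. \<lbrakk>s \<in> A; t \<in> A; s < t\<rbrakk> \<Longrightarrow> d \<le> real (t - s)"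
    and "A \<noteq> {}" "A \<subseteq> {a..<a + K}"
  shows "(real (card A) - 1) * d \<le> real K - 1"
  using assms
proof (induction K arbitrary: A rule: less_induct)
  case (less K)
  have fin: "finite A" using less.prems(3) finite_subset by blast
  define m where "m = Max A"
  have m: "m \<in> A" "\<And>s. s \<in> A \<Longrightarrow> s \<le> m" using fin less.prems(2) by (auto simp: m_def)
  have mK: "a \<le> m" "m < a + K" using m(1) less.prems(3) by auto
  show ?case
  proof (cases "A - {m} = {}")
    case True
    then have "A = {m}" using m(1) by blast
    then show ?thesis using mK by simp
  next
    case False
    define p where "p = Max (A - {m})"
    have p: "p \<in> A - {m}" "\<And>s. s \<in> A - {m} \<Longrightarrow> s \<le> p"
      using fin False Max_in[of "A - {m}"] by (auto simp: p_def)
    have pm: "p < m" using p(1) m(2)[of p] by auto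
    have ap: "a \<le> p" using p(1) less.prems(3) by auto
    \<comment> \<open>The window is cut to end exactly at the second largest point \<open>p\<close>,
      so that the gap \<open>m - p\<close> accounts for the lost \<open>d\<close>.\<close>
    have "(real (card (A - {m})) - 1) * d \<le> real (Suc p - a) - 1"
    proof (rule less.IH)
      show "Suc p - a < K" using pm mK by linarith
      show "A - {m} \<subseteq> {a..<a + (Suc p - a)}"
        using p(2) less.prems(3) ap by (fastforce simp: less_Suc_eq_le)
    qed (use False less.prems(1) in auto)
    moreover have "d \<le> real (m - p)" using less.prems(1) p(1) m(1) pm by blast
    moreover have "real (card (A - {m})) = real (card A) - 1"
      using fin m(1) by (metis card.remove add_diff_cancel_left' of_nat_Suc)
    moreover have "real (Suc p - a) - 1 + real (m - p) \<le> real K - 1"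
      using pm ap mK by linarith
    ultimately show ?thesis by (simp add: left_diff_distrib)
  qed
qed

text \<open>Double counting of pairs of a day in the window and a blocking edge scheduled on it. The
  bound on \<open>K\<close> involves \<open>K - 1\<close>, the span of the window; this slack later
  lets the window grow one day at a time.\<close>

lemma blocked_period_le:
  assumes inst: "ops_instance P R g" and le1: "\<And>v. v \<in> P \<Longrightarrow> vertex_growth R g v \<le> 1"
    and hot: "\<And>f t. f \<in> S t \<Longrightarrow> heat g S t f \<ge> x"
    and e: "e \<in> R" and x: "x > 0" and K: "(real K - 1) * g e \<le> x / 2"
    and blocked: "\<And>s. s \<in> {a..<a + K} \<Longrightarrow>
      e \<notin> S s \<and> (\<exists>f\<in>S s. f \<in> R \<and> f \<inter> e \<noteq> {} \<and> g f \<ge> g e)"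
  shows "real K * g e \<le> 2 - 2 * g e"
proof -
  interpret ops_instance P R g by fact
  have finR: "finite R"
    using edges finite_P by (rule_tac finite_subset[of _ "Pow P"]) auto
  obtain u v where uv: "e = {u, v}" "u \<in> P" "v \<in> P" using edges e by blast
  have ge: "g e > 0" using growth_pos e .
  \<comment> \<open>\<open>e\<close> is left out, since it is never scheduled in the window; its
    absence at both endpoints yields the final \<open>- 2 * g e\<close>.\<close>
  define F where "F = {f \<in> R. f \<inter> e \<noteq> {} \<and> f \<noteq> e \<and> g f \<ge> g e}"
  define N where "N f = {s \<in> {a..<a + K}. f \<in> S s}" for f
  have finF: "finite F" using finR by (simp add: F_def)
  have N_le: "real (card (N f)) * g e \<le> g f" if f: "f \<in> F" for f
  proof (cases "N f = {}")
    case True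
    then show ?thesis using f ge by (simp add: F_def)
  next
    case False
    have gf: "g f > 0" "g f \<ge> g e" using f ge by (auto simp: F_def)
    have "(real (card (N f)) - 1) * (x / g f) \<le> real K - 1"
    proof (rule card_separated_le)
      fix s t assume "s \<in> N f" "t \<in> N f" "s < t"
      then have "x \<le> real (t - s) * g f"
        using hot[of f t] heat_after_scheduling[of g f S s t] gf by (auto simp: N_def)
      then show "x / g f \<le> real (t - s)" using gf by (simp add: field_simps)
    qed (use False in \<open>auto simp: N_def\<close>)
    then have "(real (card (N f)) - 1) * (x / g f) * g e \<le> (real K - 1) * g e"
      using ge by (intro mult_right_mono) auto
    also note K
    finally have "x * ((real (card (N f)) - 1) * g e) \<le> x * (g f / 2)"
      using gf by (simp add: field_simps)
    then have *: "(real (card (N f)) - 1) * g e \<le> g f / 2" using x by simp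
    show ?thesis
    \<comment> \<open>In the first case the count is an integer below 2, hence at most 1, and
      \<open>g e \<le> g f\<close>. In the second, \<open>g e \<le> g f / 2\<close> pays for the one
      occurrence not covered by \<open>*\<close>.\<close>
    proof (cases "g f < 2 * g e")
      case True
      then have "(real (card (N f)) - 1) * g e < 1 * g e" using * by simp
      then have "real (card (N f)) - 1 < 1" using ge mult_less_cancel_right_pos by blast
      then have "real (card (N f)) \<le> 1" by simp
      then have "real (card (N f)) * g e \<le> 1 * g e" using ge by (intro mult_right_mono) auto
      then show ?thesis using gf by simp
    next
      case False
      then show ?thesis using * by (simp add: left_diff_distrib)
    qed
  qed
  have "{a..<a + K} \<subseteq> (\<Union>f\<in>F. N f)"
  proof
    fix s assume s: "s \<in> {a..<a + K}"
    with blocked[OF s] show "s \<in> (\<Union>f\<in>F. N f)" unfolding F_def N_def by blast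
  qed
  then have "card {a..<a + K} \<le> card (\<Union>f\<in>F. N f)"
    using finF by (intro card_mono) (auto simp: N_def)
  also have "\<dots> \<le> (\<Sum>f\<in>F. card (N f))" using finF by (rule card_UN_le)
  finally have "real K \<le> (\<Sum>f\<in>F. real (card (N f)))" by (simp flip: of_nat_sum)
  then have "real K * g e \<le> (\<Sum>f\<in>F. real (card (N f))) * g e"
    using ge by (intro mult_right_mono) auto
  also have "\<dots> = (\<Sum>f\<in>F. real (card (N f)) * g e)" by (rule sum_distrib_right)
  also have "\<dots> \<le> (\<Sum>f\<in>F. g f)" using N_le by (rule sum_mono)
  also have "\<dots> \<le> (\<Sum>f\<in>{f \<in> R. u \<in> f} - {e} \<union> ({f \<in> R. v \<in> f} - {e}). g f)"
    by (rule sum_mono2) (use finR growth_pos in \<open>auto simp: F_def uv(1) less_imp_le\<close>)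
  also have "\<dots> \<le> (\<Sum>f\<in>{f \<in> R. u \<in> f} - {e}. g f) + (\<Sum>f\<in>{f \<in> R. v \<in> f} - {e}. g f)"
  proof -
    have "0 \<le> (\<Sum>f\<in>({f \<in> R. u \<in> f} - {e}) \<inter> ({f \<in> R. v \<in> f} - {e}). g f)"
      using growth_pos by (intro sum_nonneg) (auto intro: less_imp_le)
    then show ?thesis using finR by (subst sum_Un) auto
  qed
  also have "\<dots> = (vertex_growth R g u - g e) + (vertex_growth R g v - g e)"
    using finR e uv(1) by (simp add: vertex_growth_def sum_diff1)
  also have "\<dots> \<le> 2 - 2 * g e" using le1[OF uv(2)] le1[OF uv(3)] by simp
  finally show ?thesis .
qed

text \<open>\<open>k\<close> counts the days just before \<open>t\<close> on which \<open>e\<close>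
  was hot but not scheduled. On the day such a wait begins the heat is below \<open>x + g e\<close>,
  and each day of waiting adds \<open>g e\<close>.\<close>

lemma heat_le_waiting:
  assumes "x > 0"
  shows "\<exists>k\<le>t. heat g S t e < x + (real k + 1) * g e \<and>
    (\<forall>s\<in>{t - k..<t}. e \<notin> S s \<and> heat g S s e \<ge> x)"
proof (induction t)
  case 0
  then show ?case using assms by simp
next
  case (Suc t)
  show ?case
  proof (cases "e \<in> S t \<or> heat g S t e < x")
    case True
    \<comment> \<open>The wait restarts: the new heat is \<open>g e\<close> after a reset, and below
      \<open>x + g e\<close> otherwise.\<close>
    then show ?thesis using assms by (intro exI[of _ 0]) auto
  next
    case False
    from Suc obtain k where "k \<le> t" "heat g S t e < x + (real k + 1) * g e"
      "\<forall>s\<in>{t - k..<t}. e \<notin> S s \<and> heat g S s e \<ge> x" by blast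
    with False have "Suc k \<le> Suc t" "heat g S (Suc t) e < x + (real (Suc k) + 1) * g e"
      "\<forall>s\<in>{Suc t - Suc k..<Suc t}. e \<notin> S s \<and> heat g S s e \<ge> x"
      by (simp_all add: distrib_right atLeastLessThanSuc)
    then show ?thesis by blast
  qed
qed

text \<open>The margin \<open>g e\<close> is kept because a strict bound by \<open>x + 2\<close>
  alone could be lost in the supremum over all days.\<close>

lemma reduce_fastest_heat_bound:
  assumes inst: "ops_instance P R g" and norm: "normalised P R g"
    and ord: "growth_order R g es" and x: "x \<ge> 4" and e: "e \<in> R"
  shows "heat g (reduce_fastest P R g es x) t e < x + 2 - g e"
proof -
  interpret ops_instance P R g by fact
  let ?S = "reduce_fastest P R g es x"
  have S: "?S t = greedy_matching x es (heat g ?S t)" for t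
    using norm rf_heat_eq_heat[of x P R g es t]
    by (simp add: reduce_fastest_def Let_def normalised_def)
  have hot: "heat g ?S t f \<ge> x" if "f \<in> ?S t" for f t
    using that greedy_matching_hot S by metis
  have le1: "vertex_growth R g v \<le> 1" if "v \<in> P" for v
    using norm finite_P that Max_ge[of "vertex_growth R g ` P" "vertex_growth R g v"]
    by (simp add: normalised_def max_growth_def)
  have ge: "g e > 0" using growth_pos e .
  obtain k where k: "k \<le> t" "heat g ?S t e < x + (real k + 1) * g e"
    and wait: "\<forall>s\<in>{t - k..<t}. e \<notin> ?S s \<and> heat g ?S s e \<ge> x"
    using heat_le_waiting[of x t g ?S e] x by auto
  \<comment> \<open>Here \<open>x \<ge> 4\<close> enters: it gives
    \<open>2 \<le> x / 2\<close>.\<close>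
  have period: "real K * g e \<le> 2 - 2 * g e" if "K \<le> k" "(real K - 1) * g e \<le> 2" for K
  proof (rule blocked_period_le[OF inst le1 hot e, where a = "t - k"])
    fix s assume s: "s \<in> {t - k..<t - k + K}"
    then have w: "e \<notin> ?S s" "heat g ?S s e \<ge> x" using wait that(1) k(1) by auto
    have "sorted_wrt (\<lambda>e f. g e \<ge> g f) es" "e \<in> set es" "set es = R"
      using ord e by (auto simp: growth_order_def)
    then show "e \<notin> ?S s \<and> (\<exists>f\<in>?S s. f \<in> R \<and> f \<inter> e \<noteq> {} \<and> g f \<ge> g e)"
      using greedy_matching_blocked[of g es e x "heat g ?S s"] w S[of s] by metis
  qed (use x that in auto)
  \<comment> \<open>Bootstrapping: the bound for \<open>j\<close> implies
    \<open>real j * g e \<le> 2\<close>, which is the side condition of \<open>period\<close> for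
    \<open>Suc j\<close>. Thus the whole wait of \<open>k\<close> days is reached with no prior
    bound on \<open>k\<close>.\<close>
  have "real j * g e \<le> 2 - 2 * g e" if "j \<le> k" for j
    using that
  proof (induction j)
    case 0
    show ?case using period[of 0] ge by simp
  next
    case (Suc j)
    then show ?case using ge by (intro period) auto
  qed
  from this[of k] k(2) show ?thesis by (simp add: algebra_simps)
qed

theorem theorem7:
  fixes P :: "'v set" and R :: "'v set set" and g :: "'v set \<Rightarrow> real"
    and es :: "'v set list" and x :: real
  assumes "ops_instance P R g"
    and "normalised P R g"
    and "growth_order R g es"
    and "x \<ge> 4"
  shows "max_heat R g (reduce_fastest P R g es x) < ereal (x + 2)"
proof (cases "R = {}")
  case True
  then show ?thesis by (simp add: max_heat_def bot_ereal_def)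
next
  case False
  have finR: "finite R" using assms(3) by (auto simp: growth_order_def)
  \<comment> \<open>By finiteness of \<open>R\<close> the least growth rate is a positive margin
    common to all edges and days.\<close>
  define m where "m = Min (g ` R)"
  have m: "m \<le> g e" if "e \<in> R" for e using finR that by (simp add: m_def)
  have "m \<in> g ` R" using finR False by (simp add: m_def)
  then have "m > 0" using ops_instance.growth_pos[OF assms(1)] by auto
  have "max_heat R g (reduce_fastest P R g es x) \<le> ereal (x + 2 - m)"
    unfolding max_heat_def
  proof (intro SUP_least)
    fix e t assume "e \<in> R"
    then show "ereal (heat g (reduce_fastest P R g es x) t e) \<le> ereal (x + 2 - m)"
      using reduce_fastest_heat_bound[OF assms, of e t] m[of e] by simp
  qed
  also have "\<dots> < ereal (x + 2)" using \<open>m > 0\<close> by simp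
  finally show ?thesis .
qed

end
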